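(* Let $n\ge4$ be an integer. Let $\mathbf p:=(p_2,\ldots,p_n)\in\mathbb Z_{\ge2}^{n-1}$ be a vector of pairwise coprime integers with $k_{\mathbf p}=n-2$. Define $$\mathbf w:=\left(1,\frac{\prod_{i=2}^np_i}{p_2},\ldots,\frac{\prod_{i=2}^np_i}{p_n}\right)\in\mathbb Z_{\ge1}^n.$$ Then all of the following hold: (a) $\mathbf w$ is well-formed; (b) there exists a $\mathbf w$-bubble $\mathbf u$ with $\mathbf w\cdot\mathbf u=(n-2)d_{\mathbf w}$ for which there exists $i\in\{1,\ldots,n\}$ such that for all positive integers $m$, $$\mathbf u+\frac{\left((n-3)m-\left\lfloor\frac{\mathbf w\cdot\mathbf u}{d_{\mathbf w}}\right\rfloor\right)d_{\mathbf w}}{w_i}\,\mathbf e_i\notin mV_{\mathbf w}^+((n-3)d_{\mathbf w});$$ (c) every $\mathbf w$-bubble $\mathbf u'$ satisfies $\mathbf w\cdot\mathbf u'<(n-1)d_{\mathbf w}$.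
   Context: Definition of $k_{\mathbf p}$: for an integer $\ell\ge2$ and pairwise coprime integers $p_1,\ldots,p_\ell$ greater than $1$, there is a unique $\mathbf a\in\mathbb Z_{\ge0}^\ell$ with $a_i<p_i$ for all $i$ such that $\sum_{i=1}^\ell\frac{a_i}{p_i}+\prod_{i=1}^\ell\frac1{p_i}$ is an integer; this integer is denoted $k_{\mathbf p}$ (here applied with $\ell=n-1$ to the $n-1$ entries of $\mathbf p$). A vector $\mathbf w=(w_1,\ldots,w_n)$ of positive integers is well-formed if $n=w_1=1$ or $\gcd(\{w_i\mid i\in I\})=1$ for every $(n-1)$-element subset $I$ of $\{1,\ldots,n\}$. Notation: $d_{\mathbf w}=\operatorname{lcm}(w_1,\ldots,w_n)$; $\mathbf a\cdot\mathbf b=\sum_ia_ib_i$; $\mathbf e_i$ is the $i$th unit vector; $\mathbf a\preceq\mathbf b$ means $a_i\le b_i$ for all $i$. For a positive integer $m$, $V^+_{\mathbf w}(m)=\{\mathbf v\in\mathbb Z_{\ge0}^n\mid\mathbf w\cdot\mathbf v\ge m\}$; for $S\subseteq\mathbb Z_{\ge0}^n$, $mS$ is the Minkowski sum $S+\ldots+S$ with $m$ summands. A $\mathbf w$-bubble is an element $\mathbf u\in\mathbb Z_{\ge0}^n$ such that $\mathbf w\cdot\mathbf u\ge2d_{\mathbf w}$ and there is no $\mathbf v\in\mathbb Z_{\ge0}^n$ with $\mathbf w\cdot\mathbf v=d_{\mathbf w}$ and $\mathbf v\preceq\mathbf u$. *)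

theory Defs
  imports Complex_Main "HOL-Library.Function_Algebras" "HOL-Library.Set_Algebras"
begin

(* A vector (v_1, ..., v_n) of integers is a function v :: nat => int that vanishes outside
   {1..n}.  With this convention addition and the componentwise order of vectors are the
   pointwise + and \<le> on functions. *)

definition nonneg_vecs :: "nat \<Rightarrow> (nat \<Rightarrow> int) set" where
  "nonneg_vecs n = {v. (\<forall>i\<in>{1..n}. 0 \<le> v i) \<and> (\<forall>i. i \<notin> {1..n} \<longrightarrow> v i = 0)}"

definition dot :: "nat \<Rightarrow> (nat \<Rightarrow> int) \<Rightarrow> (nat \<Rightarrow> int) \<Rightarrow> int" where
  "dot n a b = (\<Sum>i\<in>{1..n}. a i * b i)"

definition unit_vector :: "nat \<Rightarrow> nat \<Rightarrow> int" where
  "unit_vector i = (\<lambda>j. if j = i then 1 else 0)"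

definition lcm_weight :: "nat \<Rightarrow> (nat \<Rightarrow> int) \<Rightarrow> int" where
  "lcm_weight n w = Lcm (w ` {1..n})"

definition well_formed :: "nat \<Rightarrow> (nat \<Rightarrow> int) \<Rightarrow> bool" where
  "well_formed n w \<longleftrightarrow>
     (\<forall>i\<in>{1..n}. 0 < w i) \<and>
     (n = 1 \<and> w 1 = 1 \<or>
      (\<forall>I. I \<subseteq> {1..n} \<and> card I + 1 = n \<longrightarrow> Gcd (w ` I) = 1))"

(* The integer k_p of a family of pairwise coprime integers p i > 1, indexed by a finite set I
   with at least two elements; the description is proper only for such families. *)
definition k_of :: "nat set \<Rightarrow> (nat \<Rightarrow> int) \<Rightarrow> int" where
  "k_of I p = (THE k. \<exists>a :: nat \<Rightarrow> int. (\<forall>i\<in>I. 0 \<le> a i \<and> a i < p i) \<and>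
     (\<Sum>i\<in>I. rat_of_int (a i) / rat_of_int (p i)) + (\<Prod>i\<in>I. 1 / rat_of_int (p i)) = rat_of_int k)"

definition V_plus :: "nat \<Rightarrow> (nat \<Rightarrow> int) \<Rightarrow> int \<Rightarrow> (nat \<Rightarrow> int) set" where
  "V_plus n w m = {v \<in> nonneg_vecs n. dot n w v \<ge> m}"

(* The sum is taken in the commutative monoid of sets under elementwise addition. *)
definition minkowski_multiple :: "nat \<Rightarrow> (nat \<Rightarrow> int) set \<Rightarrow> (nat \<Rightarrow> int) set" where
  "minkowski_multiple m S = (\<Sum>j\<in>{1..m}. S)"

definition bubble :: "nat \<Rightarrow> (nat \<Rightarrow> int) \<Rightarrow> (nat \<Rightarrow> int) \<Rightarrow> bool" where
  "bubble n w u \<longleftrightarrow>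
     u \<in> nonneg_vecs n \<and> dot n w u \<ge> 2 * lcm_weight n w \<and>
     \<not> (\<exists>v \<in> nonneg_vecs n. dot n w v = lcm_weight n w \<and> v \<le> u)"

(* u + ((c m - floor(w.u / d)) d / w_i) e_i with d = lcm(w_1, ..., w_n).  The coefficient may be
   negative; the integer division by w_i is exact because w_i divides d. *)
definition shifted_vec ::
  "nat \<Rightarrow> (nat \<Rightarrow> int) \<Rightarrow> (nat \<Rightarrow> int) \<Rightarrow> int \<Rightarrow> nat \<Rightarrow> nat \<Rightarrow> nat \<Rightarrow> int" where
  "shifted_vec n w u c m i =
     u + (\<lambda>j. ((c * int m - \<lfloor>rat_of_int (dot n w u) / rat_of_int (lcm_weight n w)\<rfloor>)
                 * lcm_weight n w) div w i * unit_vector i j)"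

end

theory Submission
  imports Defs "HOL-Number_Theory.Cong"
begin

text \<open>
  Write \<open>P = p\<^sub>2 \<dots> p\<^sub>n\<close>, so that \<open>d\<^sub>w = P\<close>. If \<open>w \<cdot> v\<close> is a multiple of \<open>P\<close> and \<open>v\<^sub>1 = 0\<close>,
  then reduction modulo \<open>p\<^sub>j\<close> shows \<open>p\<^sub>j dvd v\<^sub>j\<close> for all \<open>j\<close>; this rigidity is what
  obstructs decompositions. The bubble in (b) is \<open>u = (1, a)\<close>, where \<open>a\<close> is the vector defining \<open>k\<^sub>p\<close>,
  and the direction is \<open>i = 2\<close>: in a decomposition of the shifted vector every summand has weight
  exactly \<open>(n-3) P\<close>, and each summand with vanishing first entry must be \<open>(n-3) p\<^sub>2 e\<^sub>2\<close>. All but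
  one summand are of this kind, which is more than the second entry allows.
  For (c), a bubble \<open>u'\<close> has \<open>u'\<^sub>j < p\<^sub>j\<close> for \<open>j \<ge> 2\<close>, so \<open>w \<cdot> u' \<ge> (n-1) P\<close> would force
  \<open>u'\<^sub>1 \<ge> w\<^sub>j\<close> for all \<open>j\<close>. Removing unit vectors greedily then reaches weight exactly \<open>P\<close>.
\<close>

section \<open>Divisibility for pairwise coprime families and their cofactors\<close>

locale coprime_family =
  fixes I :: "nat set" and p :: "nat \<Rightarrow> int"
  assumes finite_I: "finite I"
    and gt_one: "i \<in> I \<Longrightarrow> p i > 1"
    and pairwise_coprime: "pairwise (\<lambda>i j. coprime (p i) (p j)) I"
begin

definition P :: int where "P = (\<Prod>i\<in>I. p i)"

definition cofactor :: "nat \<Rightarrow> int" where "cofactor j = (\<Prod>i\<in>I - {j}. p i)"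

lemma P_pos: "P > 0"
  unfolding P_def using gt_one by (intro prod_pos) force

lemma cofactor_pos: "cofactor j > 0"
  unfolding cofactor_def using gt_one by (intro prod_pos) force

lemma mult_cofactor: "j \<in> I \<Longrightarrow> p j * cofactor j = P"
  unfolding P_def cofactor_def using finite_I by (simp add: prod.remove)

lemma div_eq_cofactor: "j \<in> I \<Longrightarrow> P div p j = cofactor j"
  using mult_cofactor[of j] gt_one[of j] by (metis nonzero_mult_div_cancel_left not_one_less_zero)

lemma dvd_P: "j \<in> I \<Longrightarrow> p j dvd P"
  using mult_cofactor by (metis dvd_triv_left)

lemma dvd_cofactor: "i \<in> I \<Longrightarrow> i \<noteq> j \<Longrightarrow> p i dvd cofactor j"
  unfolding cofactor_def using finite_I by (intro dvd_prodI) auto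

lemma coprime_cofactor: "j \<in> I \<Longrightarrow> coprime (p j) (cofactor j)"
  unfolding cofactor_def using pairwise_coprime
  by (intro prod_coprime_right) (auto simp: pairwise_def)

text \<open>Every other cofactor contains the factor \<open>p j\<close>, so only the
  \<open>j\<close>-th term survives modulo \<open>p j\<close>. Rigidity is the case
  \<open>c = 0\<close>; the equation for \<open>k_of\<close> is the case
  \<open>c = 1\<close>.\<close>

lemma dvd_sum_cofactor_iff:
  assumes "j \<in> I"
  shows "p j dvd (\<Sum>i\<in>I. v i * cofactor i) + c \<longleftrightarrow> p j dvd v j * cofactor j + c"
proof -
  have "p j dvd (\<Sum>i\<in>I - {j}. v i * cofactor i)"
    using assms by (intro dvd_sum dvd_mult dvd_cofactor) auto
  moreover have "(\<Sum>i\<in>I. v i * cofactor i) = v j * cofactor j + (\<Sum>i\<in>I - {j}. v i * cofactor i)"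
    using assms finite_I by (simp add: sum.remove)
  ultimately show ?thesis
    using dvd_add_right_iff[of "p j" "\<Sum>i\<in>I - {j}. v i * cofactor i" "v j * cofactor j + c"]
    by (simp add: ac_simps)
qed

lemma dvd_coeff:
  assumes "P dvd (\<Sum>i\<in>I. v i * cofactor i)" "j \<in> I"
  shows "p j dvd v j"
proof -
  have "p j dvd v j * cofactor j"
    using dvd_sum_cofactor_iff[of j v 0] assms dvd_trans[OF dvd_P] by simp
  then show ?thesis
    using coprime_cofactor[OF assms(2)] by (simp add: coprime_dvd_mult_left_iff)
qed

lemma P_dvd_iff: "P dvd x \<longleftrightarrow> (\<forall>j\<in>I. p j dvd x)"
proof
  assume "\<forall>j\<in>I. p j dvd x"
  with finite_I pairwise_coprime show "P dvd x"
    unfolding P_def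
  proof (induction I rule: finite_induct)
    case (insert i F)
    have "coprime (p i) (\<Prod>i\<in>F. p i)"
      using insert by (intro prod_coprime_right) (auto simp: pairwise_def)
    moreover have "(\<Prod>i\<in>F. p i) dvd x"
      using insert by (auto simp: pairwise_insert)
    ultimately show ?case
      using insert by (simp add: divides_mult)
  qed auto
qed (use dvd_P dvd_trans in blast)

section \<open>Existence and uniqueness of \<open>k_of\<close>\<close>

text \<open>The equation defining \<open>k\<^sub>p\<close>, with denominators cleared.\<close>

definition solves :: "(nat \<Rightarrow> int) \<Rightarrow> int \<Rightarrow> bool" where
  "solves a k \<longleftrightarrow> (\<forall>i\<in>I. 0 \<le> a i \<and> a i < p i) \<and> (\<Sum>i\<in>I. a i * cofactor i) + 1 = k * P"

lemma k_of_alt: "k_of I p = (THE k. \<exists>a. solves a k)"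
proof -
  have "(\<Sum>i\<in>I. rat_of_int (a i) / rat_of_int (p i)) + (\<Prod>i\<in>I. 1 / rat_of_int (p i)) = rat_of_int k
      \<longleftrightarrow> (\<Sum>i\<in>I. a i * cofactor i) + 1 = k * P" for a k
  proof -
    have P: "rat_of_int P \<noteq> 0" using P_pos by simp
    have "rat_of_int (a i) / rat_of_int (p i) = rat_of_int (a i * cofactor i) / rat_of_int P"
      if "i \<in> I" for i
      unfolding mult_cofactor[OF that, symmetric] using gt_one[OF that] cofactor_pos[of i] by simp
    moreover have "(\<Prod>i\<in>I. 1 / rat_of_int (p i)) = 1 / rat_of_int P"
      by (simp add: P_def prod_dividef)
    ultimately have "(\<Sum>i\<in>I. rat_of_int (a i) / rat_of_int (p i)) + (\<Prod>i\<in>I. 1 / rat_of_int (p i))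
        = rat_of_int ((\<Sum>i\<in>I. a i * cofactor i) + 1) / rat_of_int P"
      by (simp add: sum_divide_distrib add_divide_distrib)
    moreover have "\<dots> = rat_of_int k \<longleftrightarrow>
        rat_of_int ((\<Sum>i\<in>I. a i * cofactor i) + 1) = rat_of_int (k * P)"
      using P by (simp add: divide_eq_eq)
    ultimately show ?thesis
      by (simp only: of_int_eq_iff)
  qed
  then show ?thesis
    by (simp add: k_of_def solves_def)
qed

text \<open>Each entry can be chosen separately, as the least residue of minus the inverse of
  \<open>cofactor j\<close> modulo \<open>p j\<close>; the divisibilities by the \<open>p j\<close>
  then combine to divisibility by \<open>P\<close>.\<close>

lemma solves_exists: "\<exists>a k. solves a k"
proof -
  have "\<exists>b. 0 \<le> b \<and> b < p j \<and> p j dvd b * cofactor j + 1" if j: "j \<in> I" for j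
  proof -
    obtain x where "[cofactor j * x = 1] (mod p j)"
      using coprime_cofactor[OF j] cong_solve_coprime_int[of "cofactor j" "p j"]
      by (metis coprime_commute)
    then have x: "p j dvd cofactor j * x - 1"
      by (simp add: cong_iff_dvd_diff)
    define b where "b = - x mod p j"
    have "b = - x - p j * (- x div p j)"
      unfolding b_def by (rule minus_mult_div_eq_mod[symmetric])
    then have "b * cofactor j + 1 =
        - (cofactor j * x - 1) - p j * ((- x div p j) * cofactor j)"
      by (simp only: left_diff_distrib) (simp add: mult.assoc mult.commute[of x])
    also have "p j dvd \<dots>"
      using x by (intro dvd_diff) (simp_all only: dvd_minus_iff dvd_triv_left)
    finally show ?thesis
      using gt_one[OF j] by (intro exI[of _ b]) (simp add: b_def)
  qed
  then obtain a where a: "\<forall>j\<in>I. 0 \<le> a j \<and> a j < p j \<and> p j dvd a j * cofactor j + 1"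
    by metis
  then have "P dvd (\<Sum>i\<in>I. a i * cofactor i) + 1"
    by (simp add: P_dvd_iff dvd_sum_cofactor_iff)
  then obtain k where "(\<Sum>i\<in>I. a i * cofactor i) + 1 = k * P"
    by (metis dvd_def mult.commute)
  with a show ?thesis
    unfolding solves_def by blast
qed

text \<open>By rigidity, two solutions differ by a multiple of \<open>p j\<close> in entry
  \<open>j\<close>; as both entries are residues below \<open>p j\<close>, they agree.\<close>

lemma solves_unique:
  assumes "solves a k" "solves b l"
  shows "k = l"
proof -
  have "(\<Sum>i\<in>I. (a i - b i) * cofactor i) = (k - l) * P"
    using assms by (simp add: solves_def left_diff_distrib sum_subtractf)
  then have "p j dvd a j - b j" if "j \<in> I" for j
    using that dvd_coeff[of "\<lambda>i. a i - b i"] by simp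
  then have "a j = b j" if "j \<in> I" for j
    using that assms zdvd_imp_le[of "p j" "\<bar>a j - b j\<bar>"] by (force simp: solves_def)
  then have "k * P = l * P"
    using assms by (simp add: solves_def)
  then show ?thesis using P_pos by simp
qed

lemma k_of_solves: "\<exists>a. solves a (k_of I p)"
proof -
  obtain a k where "solves a k" using solves_exists by blast
  then have "\<exists>!k. \<exists>a. solves a k" using solves_unique by blast
  then show ?thesis unfolding k_of_alt by (rule theI')
qed

end

section \<open>The weight vector: its lcm and well-formedness\<close>

locale reciprocal_weights = coprime_family "{2..n}" p
  for n :: nat and p :: "nat \<Rightarrow> int" +
  fixes w :: "nat \<Rightarrow> int"
  assumes n_ge: "n \<ge> 4"
    and w_one: "w 1 = 1"
    and w_cofactor: "j \<in> {2..n} \<Longrightarrow> w j = cofactor j"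
begin

lemma index_split: "{1..n} = insert 1 {2..n}"
  using n_ge by auto

lemma w_pos: "j \<in> {1..n} \<Longrightarrow> w j > 0"
  by (cases "j = 1") (auto simp: w_one[simplified] w_cofactor cofactor_pos)

lemma dot_split: "dot n w v = v 1 + (\<Sum>j\<in>{2..n}. v j * cofactor j)"
  unfolding dot_def index_split by (simp add: w_one[simplified] w_cofactor mult.commute)

lemma dot_unit: "i \<in> {1..n} \<Longrightarrow> dot n w (\<lambda>j. c * unit_vector i j) = c * w i"
  by (simp add: dot_def unit_vector_def if_distrib[of "\<lambda>x. _ * x"] cong: if_cong)

lemma dot_add: "dot n w (u + v) = dot n w u + dot n w v"
  by (simp add: dot_def distrib_left sum.distrib)

lemma dot_diff: "dot n w (u - v) = dot n w u - dot n w v"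
  by (simp add: dot_def right_diff_distrib sum_subtractf)

lemma dot_sum: "dot n w (\<Sum>k\<in>K. s k) = (\<Sum>k\<in>K. dot n w (s k))"
proof -
  have "dot n w 0 = 0" by (simp add: dot_def)
  then show ?thesis
    by (induction K rule: infinite_finite_induct) (simp_all add: dot_add)
qed

lemma lcm_weight_eq: "lcm_weight n w = P"
proof -
  have "w j dvd P" if "j \<in> {1..n}" for j
    using that mult_cofactor[of j] by (cases "j = 1") (auto simp: w_one[simplified] w_cofactor dest: sym)
  then have "lcm_weight n w dvd P"
    unfolding lcm_weight_def by (auto intro: Lcm_least)
  moreover have "p j dvd lcm_weight n w" if "j \<in> {2..n}" for j
  proof -
    \<comment> \<open>A weight \<open>w i\<close> with \<open>i \<noteq> j\<close> already contains
      the factor \<open>p j\<close>; a second index is available in \<open>{2..n}\<close>.\<close>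
    obtain i where i: "i \<in> {2..n}" "i \<noteq> j"
      using n_ge by (cases "j = 2") (auto intro: that[of 2] that[of 3])
    then have "w i dvd lcm_weight n w"
      unfolding lcm_weight_def by (intro dvd_Lcm) auto
    with i that show ?thesis
      using dvd_cofactor[of j i] w_cofactor[of i] dvd_trans by metis
  qed
  then have "P dvd lcm_weight n w" by (simp add: P_dvd_iff)
  moreover have "lcm_weight n w \<ge> 0" unfolding lcm_weight_def by simp
  ultimately show ?thesis using P_pos by (simp add: zdvd_antisym_nonneg)
qed

lemma dvd_entry:
  assumes "P dvd dot n w v" "v 1 = 0" "j \<in> {2..n}"
  shows "p j dvd v j"
  using assms dvd_coeff[of v j] by (simp add: dot_split)

lemma small_entry_zero:
  assumes "P dvd dot n w v" "v 1 = 0" "j \<in> {2..n}" "0 \<le> v j" "v j < p j"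
  shows "v j = 0"
  using dvd_entry[OF assms(1-3)] assms(4,5) zdvd_imp_le[of "p j" "v j"] by force

lemma well_formed_weights: "well_formed n w"
proof -
  have "Gcd (w ` I) = 1" if I: "I \<subseteq> {1..n}" "card I + 1 = n" for I
  proof -
    \<comment> \<open>The equation of \<open>solves\<close> acts as a Bezout identity: a common
      divisor of all cofactors divides both \<open>P\<close> and the sum, hence their difference 1.
      It settles the only set without the index 1.\<close>
    obtain a where a: "solves a (k_of {2..n} p)" using k_of_solves by blast
    have "is_unit (Gcd (w ` I))"
    proof (cases "1 \<in> I")
      case True
      then have "Gcd (w ` I) dvd w 1" by (intro Gcd_dvd) auto
      then show ?thesis by (simp add: w_one[simplified])
    next
      case False
      then have "I \<subseteq> {2..n}" using I index_split by auto
      then have I_eq: "I = {2..n}" using I by (intro card_subset_eq) auto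
      have g: "Gcd (w ` I) dvd cofactor j" if "j \<in> {2..n}" for j
        using that w_cofactor[of j] I_eq by (metis Gcd_dvd imageI)
      then have "Gcd (w ` I) dvd (\<Sum>j\<in>{2..n}. a j * cofactor j)"
        by (intro dvd_sum dvd_mult) auto
      moreover have "Gcd (w ` I) dvd P"
        using dvd_mult[OF g[of 2], of "p 2"] mult_cofactor[of 2] n_ge by simp
      then have "Gcd (w ` I) dvd (\<Sum>j\<in>{2..n}. a j * cofactor j) + 1"
        using a by (simp add: solves_def)
      ultimately show ?thesis
        using dvd_add_right_iff by blast
    qed
    then show ?thesis by simp
  qed
  then show ?thesis using w_pos by (auto simp: well_formed_def)
qed

section \<open>The bubble of (b)\<close>

definition lift_vec :: "(nat \<Rightarrow> int) \<Rightarrow> nat \<Rightarrow> int" where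
  "lift_vec a = (\<lambda>i. if i = 1 then 1 else if i \<in> {2..n} then a i else 0)"

lemma lift_vec_simps: "lift_vec a 1 = 1" "j \<in> {2..n} \<Longrightarrow> lift_vec a j = a j"
  by (auto simp: lift_vec_def)

text \<open>The first entry, of weight 1, supplies the \<open>+ 1\<close> in
  \<open>solves\<close>.\<close>

lemma dot_lift_vec: "solves a k \<Longrightarrow> dot n w (lift_vec a) = k * P"
  using lift_vec_simps(1)
  by (simp add: dot_split lift_vec_simps(2) solves_def)

text \<open>A subvector \<open>v\<close> of weight \<open>P\<close> has first entry 0 or 1. In the
  first case rigidity applies to \<open>v\<close>, in the second to the complement, of weight
  \<open>(k - 1) * P\<close>. All entries are below \<open>p j\<close>, so the weight would be
  0.\<close>

lemma bubble_lift_vec: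
  assumes a: "solves a k" and k: "k \<ge> 2"
  shows "bubble n w (lift_vec a)"
proof -
  let ?u = "lift_vec a"
  have a_bounds: "0 \<le> a j" "a j < p j" if "j \<in> {2..n}" for j
    using a that by (auto simp: solves_def)
  have zero: "dot n w v = 0"
    if "P dvd dot n w v" "v 1 = 0" "\<And>j. j \<in> {2..n} \<Longrightarrow> 0 \<le> v j \<and> v j \<le> a j" for v
    using small_entry_zero[OF that(1,2)] that(2,3) a_bounds(2)
    by (fastforce simp: dot_split intro!: sum.neutral)
  have False if v: "v \<in> nonneg_vecs n" "dot n w v = P" "v \<le> ?u" for v
  proof -
    have le: "v i \<le> ?u i" for i using v(3) by (simp add: le_fun_def)
    have nn: "0 \<le> v i" if "i \<in> {1..n}" for i using v(1) that by (auto simp: nonneg_vecs_def)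
    have "v 1 = 0 \<or> v 1 = 1"
      using le[of 1] nn[of 1] n_ge lift_vec_simps(1)[of a] by auto
    then show False
    proof
      assume "v 1 = 0"
      moreover have "0 \<le> v j \<and> v j \<le> a j" if "j \<in> {2..n}" for j
        using le[of j] nn[of j] that lift_vec_simps(2)[of j a] by auto
      ultimately show False using zero[of v] v(2) P_pos by simp
    next
      assume v1: "v 1 = 1"
      have dot: "dot n w (?u - v) = (k - 1) * P"
        using v(2) a by (simp add: dot_diff dot_lift_vec algebra_simps)
      have "0 \<le> (?u - v) j \<and> (?u - v) j \<le> a j" if "j \<in> {2..n}" for j
        using le[of j] nn[of j] that lift_vec_simps(2)[of j a] by auto
      then have "dot n w (?u - v) = 0"
        using v1 lift_vec_simps(1)[of a] by (intro zero) (auto simp: dot)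
      then show False using dot k P_pos by simp
    qed
  qed
  moreover have "?u \<in> nonneg_vecs n"
    using a_bounds n_ge by (auto simp: nonneg_vecs_def lift_vec_def)
  ultimately show ?thesis
    using a k P_pos by (auto simp: bubble_def lcm_weight_eq dot_lift_vec)
qed

section \<open>The obstruction to decomposing the shifted vector\<close>

lemma shifted_lift_vec_notin:
  assumes a: "solves a k"
  shows "shifted_vec n w (lift_vec a) (k - 1) m 2
    \<notin> minkowski_multiple m (V_plus n w ((k - 1) * lcm_weight n w))"
proof
  let ?u = "lift_vec a"
  \<comment> \<open>The shift adds \<open>?N\<close> (possibly negative) times the vector
    \<open>p 2\<close> in direction 2, which has weight \<open>P\<close>. The total becomes exactly
    \<open>m * (k - 1) * P\<close>, leaving no slack for \<open>m\<close> summands.\<close>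
  let ?N = "(k - 1) * int m - k"
  have mem2: "2 \<in> {1..n}" "2 \<in> {2..n}" using n_ge by auto
  have a_bounds: "0 \<le> a j" "a j < p j" if "j \<in> {2..n}" for j
    using a that by (auto simp: solves_def)
  define x where "x = shifted_vec n w ?u (k - 1) m 2"
  have "?N * P div w 2 = ?N * p 2"
    unfolding w_cofactor[OF mem2(2)] mult_cofactor[OF mem2(2), symmetric]
    using cofactor_pos[of 2] by simp
  moreover have "\<lfloor>rat_of_int (dot n w ?u) / rat_of_int (lcm_weight n w)\<rfloor> = k"
    using a P_pos by (simp add: dot_lift_vec lcm_weight_eq)
  ultimately have x_eq: "x = ?u + (\<lambda>j. ?N * p 2 * unit_vector 2 j)"
    by (simp add: x_def shifted_vec_def lcm_weight_eq)
  have x1: "x 1 = 1" and x2: "x 2 = a 2 + ?N * p 2"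
    and xj: "j \<in> {2..n} \<Longrightarrow> j \<noteq> 2 \<Longrightarrow> x j = a j" for j
    using lift_vec_simps(1)[of a] mem2 by (auto simp: x_eq unit_vector_def lift_vec_simps(2))
  have "p 2 * w 2 = P" using mult_cofactor mem2 w_cofactor by simp
  then have "?N * p 2 * w 2 = ?N * P" by (simp only: mult.assoc)
  then have "dot n w x = k * P + ?N * P"
    by (simp only: x_eq dot_add dot_unit[OF mem2(1)] dot_lift_vec[OF a])
  then have dot_x: "dot n w x = int m * ((k - 1) * P)"
    by (simp add: algebra_simps)

  assume "shifted_vec n w ?u (k - 1) m 2
    \<in> minkowski_multiple m (V_plus n w ((k - 1) * lcm_weight n w))"
  then obtain s where s: "x = (\<Sum>k\<in>{1..m}. s k)"
    and sV: "\<And>i. i \<in> {1..m} \<Longrightarrow> s i \<in> V_plus n w ((k - 1) * P)"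
    unfolding minkowski_multiple_def x_def lcm_weight_eq by (auto simp: set_sum_alt)
  have x_sum: "x j = (\<Sum>i\<in>{1..m}. s i j)" for j
  proof -
    have "sum s K j = (\<Sum>i\<in>K. s i j)" for K
      by (induction K rule: infinite_finite_induct) auto
    then show ?thesis by (simp add: s)
  qed
  have s_nonneg: "0 \<le> s i j" if "i \<in> {1..m}" for i j
    using sV[OF that] unfolding V_plus_def nonneg_vecs_def
    by (cases "j \<in> {1..n}") auto
  have s_le: "s i j \<le> x j" if "i \<in> {1..m}" for i j
    unfolding x_sum using that s_nonneg by (intro member_le_sum) auto
  have s_dot: "dot n w (s i) = (k - 1) * P" if i: "i \<in> {1..m}" for i
  proof (rule ccontr)
    assume "dot n w (s i) \<noteq> (k - 1) * P"
    then have "(\<Sum>i\<in>{1..m}. (k - 1) * P) < (\<Sum>i\<in>{1..m}. dot n w (s i))"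
      using sV i by (intro sum_strict_mono_ex1) (force simp: V_plus_def)+
    then show False using dot_x by (simp add: s dot_sum)
  qed
  \<comment> \<open>One linear bound covers both values of \<open>s i 1\<close>: for 0 rigidity
    forces equality, for 1 it is nonnegativity. It can be summed because the first entries add up to
    1.\<close>
  have "(k - 1) * p 2 * (1 - s i 1) \<le> s i 2" if i: "i \<in> {1..m}" for i
  proof (cases "s i 1 = 0")
    case True
    have "P dvd dot n w (s i)" using s_dot[OF i] by simp
    then have "s i j = 0" if j: "j \<in> {2..n} - {2}" for j
    proof (rule small_entry_zero)
      show "s i j < p j"
        using j s_le[OF i, of j] xj[of j] a_bounds(2)[of j] by simp
    qed (use True j s_nonneg[OF i] in auto)
    then have "(\<Sum>j\<in>{2..n}. s i j * cofactor j) = s i 2 * cofactor 2"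
      using mem2 by (subst sum.remove[of _ 2]) auto
    then have "s i 2 * cofactor 2 = (k - 1) * P"
      using s_dot[OF i] True by (simp add: dot_split)
    also have "\<dots> = (k - 1) * p 2 * cofactor 2"
      using mult_cofactor[OF mem2(2)] by simp
    finally have "s i 2 = (k - 1) * p 2" using cofactor_pos[of 2] by simp
    then show ?thesis using True by simp
  next
    case False
    have "s i 1 \<ge> 1" using False s_nonneg[OF i, of 1] by simp
    moreover have "s i 1 \<le> 1" using s_le[OF i, of 1] x1 by simp
    ultimately show ?thesis using s_nonneg[OF i, of 2] by simp
  qed
  then have "(\<Sum>i\<in>{1..m}. (k - 1) * p 2 * (1 - s i 1)) \<le> x 2"
    unfolding x_sum[of 2] by (intro sum_mono) auto
  also have "(\<Sum>i\<in>{1..m}. (k - 1) * p 2 * (1 - s i 1)) = (k - 1) * p 2 * (int m - 1)"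
    using x1 x_sum[of 1] by (simp add: sum_distrib_left[symmetric] sum_subtractf)
  \<comment> \<open>Since \<open>(k - 1) * (m - 1) = ?N + 1\<close>, the second entry would be at
    least \<open>(?N + 1) * p 2\<close>, whereas \<open>a 2 < p 2\<close>.\<close>
  also have "\<dots> = ?N * p 2 + p 2" by algebra
  finally show False using a_bounds(2)[OF mem2(2)] x2 by linarith
qed

section \<open>The upper bound (c) on the weight of bubbles\<close>

lemma subvector_of_weight_P:
  assumes u: "u \<in> nonneg_vecs n" "dot n w u \<ge> P"
    and large: "\<And>j. j \<in> {2..n} \<Longrightarrow> cofactor j \<le> u 1"
  shows "\<exists>v \<in> nonneg_vecs n. dot n w v = P \<and> v \<le> u"
proof -
  \<comment> \<open>The greedy removal is phrased as minimality of weight. The first entry is kept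
    whole as a reserve of units of weight 1.\<close>
  define Q where "Q v \<longleftrightarrow> v \<in> nonneg_vecs n \<and> dot n w v \<ge> P \<and> v \<le> u \<and> v 1 = u 1" for v
  have "Q u" using u by (simp add: Q_def)
  then obtain v where v: "Q v" and least: "\<And>v'. Q v' \<Longrightarrow> nat (dot n w v) \<le> nat (dot n w v')"
    using ex_has_least_nat[of Q u "\<lambda>v. nat (dot n w v)"] by blast
  \<comment> \<open>If the excess over \<open>P\<close> were larger than \<open>v 1\<close>, some
    later entry would be positive. Removing one unit there costs at most \<open>u 1 = v 1\<close>,
    so the weight stays above \<open>P\<close>, against minimality.\<close>
  have close: "dot n w v - P \<le> v 1"
  proof (rule ccontr)
    assume far: "\<not> dot n w v - P \<le> v 1"
    then have "(\<Sum>j\<in>{2..n}. v j * cofactor j) \<noteq> 0"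
      using P_pos by (simp add: dot_split)
    then obtain j where j: "j \<in> {2..n}" "v j \<noteq> 0"
      by (metis (no_types, lifting) mult_zero_left sum.neutral)
    have nn: "i \<in> {1..n} \<Longrightarrow> 0 \<le> v i" "i \<notin> {1..n} \<Longrightarrow> v i = 0" for i
      using v by (auto simp: Q_def nonneg_vecs_def)
    have "v j > 0" using j nn(1)[of j] by force
    let ?v = "v - unit_vector j"
    have dot: "dot n w ?v = dot n w v - cofactor j"
      using j dot_unit[of j 1] by (simp add: dot_diff w_cofactor)
    have "?v \<in> nonneg_vecs n"
      using nn \<open>v j > 0\<close> j by (auto simp: nonneg_vecs_def unit_vector_def)
    moreover have "dot n w ?v \<ge> P"
      using far large[OF j(1)] v by (simp add: dot Q_def)
    moreover have "?v i \<le> u i" for i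
      using v le_funD[of v u i] by (auto simp: Q_def unit_vector_def)
    then have "?v \<le> u" by (rule le_funI)
    moreover have "?v 1 = u 1"
      using v j by (simp add: Q_def unit_vector_def)
    ultimately have "Q ?v" by (simp add: Q_def)
    from least[OF this] show False
      using \<open>dot n w ?v \<ge> P\<close> P_pos cofactor_pos[of j] by (simp add: dot)
  qed
  \<comment> \<open>The remaining excess is taken from the first entry, one unit of weight at a
    time.\<close>
  define v' where "v' = v - (\<lambda>i. (dot n w v - P) * unit_vector 1 i)"
  have "dot n w v' = P"
    unfolding v'_def using n_ge by (simp add: dot_diff dot_unit w_one[simplified])
  moreover have "v' \<in> nonneg_vecs n"
    using v close n_ge by (auto simp: v'_def nonneg_vecs_def unit_vector_def Q_def)
  moreover have "v' \<le> u"
    using v by (auto simp: v'_def le_fun_def unit_vector_def Q_def)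
  ultimately show ?thesis by blast
qed

lemma bubble_dot_less:
  assumes u: "bubble n w u"
  shows "dot n w u < (int n - 1) * P"
proof (rule ccontr)
  assume "\<not> dot n w u < (int n - 1) * P"
  then have big: "(int n - 1) * P \<le> dot n w u" by simp
  have u_nonneg: "u \<in> nonneg_vecs n" and none: "\<not> (\<exists>v \<in> nonneg_vecs n. dot n w v = P \<and> v \<le> u)"
    and "dot n w u \<ge> 2 * P"
    using u by (auto simp: bubble_def lcm_weight_eq)
  \<comment> \<open>Otherwise \<open>p j\<close> times the \<open>j\<close>-th unit vector, of
    weight \<open>P\<close>, lies below \<open>u\<close>.\<close>
  have u_less: "u j < p j" if j: "j \<in> {2..n}" for j
  proof (rule ccontr)
    assume "\<not> u j < p j"
    let ?v = "\<lambda>i. p j * unit_vector j i"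
    have "?v \<in> nonneg_vecs n" using gt_one[OF j] j by (auto simp: nonneg_vecs_def unit_vector_def)
    moreover have "dot n w ?v = P"
      using j by (simp add: dot_unit w_cofactor mult_cofactor)
    moreover have "?v i \<le> u i" for i
      using \<open>\<not> u j < p j\<close> u_nonneg
      by (cases "i \<in> {1..n}") (auto simp: unit_vector_def nonneg_vecs_def)
    ultimately show False using none by (auto simp: le_fun_def)
  qed
  \<comment> \<open>Each of the \<open>n - 1\<close> later entries falls short of \<open>P\<close>
    by at least \<open>cofactor j\<close>; the first entry must make up the sum of these
    deficits.\<close>
  have "(\<Sum>j\<in>{2..n}. u j * cofactor j) \<le> (\<Sum>j\<in>{2..n}. P - cofactor j)"
  proof (rule sum_mono)
    fix j assume j: "j \<in> {2..n}"
    have "u j * cofactor j \<le> (p j - 1) * cofactor j"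
      using u_less[OF j] cofactor_pos[of j] by (intro mult_right_mono) auto
    then show "u j * cofactor j \<le> P - cofactor j"
      using mult_cofactor[OF j] by (simp add: left_diff_distrib)
  qed
  also have "\<dots> = (int n - 1) * P - (\<Sum>j\<in>{2..n}. cofactor j)"
    using n_ge by (simp add: sum_subtractf of_nat_diff)
  finally have total: "(\<Sum>j\<in>{2..n}. cofactor j) \<le> u 1"
    using big by (simp add: dot_split)
  have "cofactor j \<le> u 1" if "j \<in> {2..n}" for j
    using total that cofactor_pos
    by (intro order_trans[OF member_le_sum total]) (auto intro: less_imp_le)
  then show False
    using subvector_of_weight_P[OF u_nonneg] none \<open>dot n w u \<ge> 2 * P\<close> P_pos by auto
qed

end

theorem theorem8p7:
  fixes n :: nat and p w :: "nat \<Rightarrow> int"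
  assumes "n \<ge> 4"
    and "\<forall>i\<in>{2..n}. p i \<ge> 2"
    and "pairwise (\<lambda>i j. coprime (p i) (p j)) {2..n}"
    and "k_of {2..n} p = int n - 2"
    and "w = (\<lambda>i. if i = 1 then 1
                  else if i \<in> {2..n} then (\<Prod>j\<in>{2..n}. p j) div p i
                  else 0)"
  shows "well_formed n w \<and>
    (\<exists>u. bubble n w u \<and> dot n w u = (int n - 2) * lcm_weight n w \<and>
       (\<exists>i\<in>{1..n}. \<forall>m::nat. m > 0 \<longrightarrow>
          shifted_vec n w u (int n - 3) m i
            \<notin> minkowski_multiple m (V_plus n w ((int n - 3) * lcm_weight n w)))) \<and>
    (\<forall>u'. bubble n w u' \<longrightarrow> dot n w u' < (int n - 1) * lcm_weight n w)"
proof -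
  interpret coprime_family "{2..n}" p
    using assms(2,3) by unfold_locales force+
  interpret reciprocal_weights n p w
    using assms(1) div_eq_cofactor by unfold_locales (auto simp: assms(5) P_def)
  \<comment> \<open>With \<open>k = n - 2\<close> the factor \<open>k - 1\<close> is
    \<open>n - 3\<close>, and \<open>n \<ge> 4\<close> gives the bound \<open>k \<ge> 2\<close>
    required of a bubble.\<close>
  obtain a where a: "solves a (int n - 2)"
    using k_of_solves assms(4) by auto
  show ?thesis
  proof (intro conjI exI[of _ "lift_vec a"] bexI[of _ 2] allI impI)
    show "shifted_vec n w (lift_vec a) (int n - 3) m 2
        \<notin> minkowski_multiple m (V_plus n w ((int n - 3) * lcm_weight n w))" for m
      using shifted_lift_vec_notin[OF a] by simp
  qed (use assms(1) a in \<open>auto simp: well_formed_weights bubble_lift_vec dot_lift_vec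
      lcm_weight_eq bubble_dot_less\<close>)
qed

end
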